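(* Let $H\ge 1$ be an integer, $\beta=(\beta_1,\dots,\beta_H)'\in\mathbb{R}^H$, $V_\beta$ a known symmetric positive-definite $H\times H$ matrix, $\hat\beta\sim N(\beta,V_\beta)$, and $\alpha\in(0,1)$. Let $\{U_h^{1-\alpha},L_h^{1-\alpha}\}_{h=1}^H$ be the cumulative plausible bounds computed from $\hat\beta$ and $V_\beta$ (defined in the context). Then the true treatment path $\beta$ is on average over the horizon within the cumulative plausible bounds with probability $1-\alpha$: $$\mathbb{P}\left(\frac{\sum_{h=1}^H L^{1-\alpha}_h}{H}< \frac{\sum_{h=1}^H \beta_h}{H} < \frac{\sum_{h=1}^H U^{1-\alpha}_h}{H}\right)=1-\alpha .$$
   Context: The vector $\beta$ is the (unknown, fixed) treatment effect path at horizons $h=1,\dots,H$, and $\hat\beta$ is its estimate. The probability is over the distribution of $\hat\beta$. Let $\kappa^{(1-\alpha)}$ denote the inverse of the cumulative distribution function of the chi-square distribution with one degree of freedom, evaluated at $1-\alpha$. Define the scalars $$u^{1-\alpha}=\max_{\beta^*\in\mathbb{R}^H}\ \sum_{h=1}^H\beta^*_h\quad\text{s.t.}\quad (\beta^*-\hat\beta)'V_\beta^{-1}(\beta^*-\hat\beta)=\kappa^{(1-\alpha)},$$ $$l^{1-\alpha}=\min_{\beta^*\in\mathbb{R}^H}\ \sum_{h=1}^H\beta^*_h\quad\text{s.t.}\quad (\beta^*-\hat\beta)'V_\beta^{-1}(\beta^*-\hat\beta)=\kappa^{(1-\alpha)}.$$ The cumulative plausible bounds are, for each $h=1,\dots,H$,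 $$U_h^{1-\alpha}=\frac{u^{1-\alpha}}{H},\qquad L_h^{1-\alpha}=\frac{l^{1-\alpha}}{H}.$$ *)

theory Defs
  imports "HOL-Probability.Probability"
begin

definition pos_definite :: "real ^ 'n ^ 'n \<Rightarrow> bool" where
  "pos_definite V \<longleftrightarrow> (\<forall>x. x \<noteq> 0 \<longrightarrow> 0 < x \<bullet> (V *v x))"

text \<open>
  Density of the multivariate normal law with mean \<open>\<mu>\<close> and covariance matrix \<open>V\<close>,
  with respect to Lebesgue measure; meaningful for symmetric positive-definite \<open>V\<close>.
\<close>
definition mv_normal_density ::
    "real ^ 'n \<Rightarrow> real ^ 'n ^ 'n \<Rightarrow> real ^ 'n \<Rightarrow> real" where
  "mv_normal_density \<mu> V x =
     exp (- ((x - \<mu>) \<bullet> (matrix_inv V *v (x - \<mu>))) / 2) /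
     sqrt ((2 * pi) ^ CARD('n) * det V)"

definition chi_square_density :: "nat \<Rightarrow> real \<Rightarrow> real" where
  "chi_square_density k x =
     (if 0 < x
      then x powr (real k / 2 - 1) * exp (- x / 2) / (2 powr (real k / 2) * Gamma (real k / 2))
      else 0)"

definition chi_square_cdf :: "nat \<Rightarrow> real \<Rightarrow> real" where
  "chi_square_cdf k = cdf (density lborel (\<lambda>x. ennreal (chi_square_density k x)))"

text \<open>
  For \<open>k \<ge> 1\<close> the distribution function vanishes on the negative half-line and is
  strictly increasing from \<open>{0..}\<close> onto \<open>{0..<1}\<close>, so the inverse is taken on \<open>{0..}\<close>.
\<close>
definition chi_square_quantile :: "nat \<Rightarrow> real \<Rightarrow> real" where
  "chi_square_quantile k = the_inv_into {0..} (chi_square_cdf k)"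

definition plausible_paths :: "real \<Rightarrow> real ^ 'n ^ 'n \<Rightarrow> real ^ 'n \<Rightarrow> (real ^ 'n) set" where
  "plausible_paths \<alpha> V b =
     {b'. (b' - b) \<bullet> (matrix_inv V *v (b' - b)) = chi_square_quantile 1 (1 - \<alpha>)}"

text \<open>
  \<open>GREATEST\<close> and \<open>LEAST\<close> on the reals denote an attained maximum and minimum, and are
  unspecified when there is none.
\<close>
definition max_cumulative :: "real \<Rightarrow> real ^ 'n ^ 'n \<Rightarrow> real ^ 'n \<Rightarrow> real" where
  "max_cumulative \<alpha> V b =
     (GREATEST s. s \<in> (\<lambda>b'. \<Sum>h\<in>UNIV. b' $ h) ` plausible_paths \<alpha> V b)"

definition min_cumulative :: "real \<Rightarrow> real ^ 'n ^ 'n \<Rightarrow> real ^ 'n \<Rightarrow> real" where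
  "min_cumulative \<alpha> V b =
     (LEAST s. s \<in> (\<lambda>b'. \<Sum>h\<in>UNIV. b' $ h) ` plausible_paths \<alpha> V b)"

definition upper_bound :: "real \<Rightarrow> real ^ 'n ^ 'n \<Rightarrow> real ^ 'n \<Rightarrow> real ^ 'n" where
  "upper_bound \<alpha> V b = (\<chi> h. max_cumulative \<alpha> V b / real CARD('n))"

definition lower_bound :: "real \<Rightarrow> real ^ 'n ^ 'n \<Rightarrow> real ^ 'n \<Rightarrow> real ^ 'n" where
  "lower_bound \<alpha> V b = (\<chi> h. min_cumulative \<alpha> V b / real CARD('n))"

end

theory Submission
  imports Defs
begin

text \<open>
  Write \<open>a = (1, \<dots>, 1)\<close>. By the Cauchy--Schwarz inequality for the form of the inverse of \<open>V\<close>,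
  the extrema of \<open>a \<bullet> x\<close> over the ellipsoid around \<open>b\<close> are \<open>a \<bullet> b \<plusminus> sqrt (\<kappa> v)\<close> with
  \<open>v = a \<bullet> V a\<close>, so the event says that \<open>\<bar>a \<bullet> (\<beta>hat - \<beta>)\<bar> < sqrt (\<kappa> v)\<close>. The law of
  \<open>a \<bullet> (\<beta>hat - \<beta>)\<close> is found without diagonalising \<open>V\<close>: multiplied by
  \<open>exp ((a \<bullet> x)\<^sup>2 / (2 v))\<close>, the centred normal density becomes invariant under translation along
  \<open>V a\<close>, so its image under \<open>x \<mapsto> a \<bullet> x\<close> is a multiple of Lebesgue measure. Hence the law has a
  density proportional to \<open>exp (- y\<^sup>2 / (2 v))\<close>, and the constant is fixed by total mass 1. The
  substitution \<open>x = z\<^sup>2\<close> identifies the probability with the chi-square distribution function at \<open>\<kappa>\<close>.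
\<close>

section \<open>Lebesgue integrals under translation, reflection and projection along
  \<open>a\<close>\<close>

lemma nn_integral_lborel_translate:
  fixes f :: "'b::euclidean_space \<Rightarrow> ennreal"
  assumes [measurable]: "f \<in> borel_measurable borel"
  shows "(\<integral>\<^sup>+x. f (c + x) \<partial>lborel) = (\<integral>\<^sup>+x. f x \<partial>lborel)"
proof -
  have "(\<integral>\<^sup>+x. f x \<partial>lborel) = (\<integral>\<^sup>+x. f x \<partial>distr lborel borel ((+) c))"
    by (simp add: lborel_distr_plus)
  also have "\<dots> = (\<integral>\<^sup>+x. f (c + x) \<partial>lborel)"
    by (subst nn_integral_distr) auto
  finally show ?thesis ..
qed

lemma nn_integral_real_reflect:
  fixes f :: "real \<Rightarrow> ennreal"
  assumes [measurable]: "f \<in> borel_measurable borel"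
  shows "(\<integral>\<^sup>+x. f (c - x) \<partial>lborel) = (\<integral>\<^sup>+x. f x \<partial>lborel)"
  using nn_integral_real_affine[of f "-1" c] by simp

text \<open>
  A factor \<open>\<integral> indicator {0..1} (a \<bullet> x + t) dt = 1\<close> is inserted, the integrals are swapped, \<open>x\<close> is
  translated by \<open>- t w\<close>, and the integrals are swapped back.
\<close>
lemma nn_integral_inner_invariant_kernel:
  fixes a w :: "'b::euclidean_space" and k :: "'b \<Rightarrow> ennreal" and G :: "real \<Rightarrow> ennreal"
  assumes [measurable]: "k \<in> borel_measurable borel" "G \<in> borel_measurable borel"
    and inv: "\<And>x t. k (t *\<^sub>R w + x) = k x"
    and aw: "a \<bullet> w = 1"
  shows "(\<integral>\<^sup>+x. G (a \<bullet> x) * k x \<partial>lborel) =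
    (\<integral>\<^sup>+y. G y \<partial>lborel) * (\<integral>\<^sup>+x. indicator {0..1::real} (a \<bullet> x) * k x \<partial>lborel)"
proof -
  let ?I = "indicator {0..1::real} :: real \<Rightarrow> ennreal"
  have one: "(\<integral>\<^sup>+t. ?I (y + t) \<partial>lborel) = 1" for y
    by (subst nn_integral_lborel_translate) auto
  have "(\<integral>\<^sup>+x. G (a \<bullet> x) * k x \<partial>lborel) =
      (\<integral>\<^sup>+x. (\<integral>\<^sup>+t. G (a \<bullet> x) * k x * ?I (a \<bullet> x + t) \<partial>lborel) \<partial>lborel)"
    by (subst nn_integral_cmult) (auto simp: one)
  also have "\<dots> = (\<integral>\<^sup>+t. (\<integral>\<^sup>+x. G (a \<bullet> x) * k x * ?I (a \<bullet> x + t) \<partial>lborel) \<partial>lborel)"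
    by (rule lborel_pair.Fubini') measurable
  also have "\<dots> = (\<integral>\<^sup>+t. (\<integral>\<^sup>+x. G (a \<bullet> x - t) * k x * ?I (a \<bullet> x) \<partial>lborel) \<partial>lborel)"
  proof (rule nn_integral_cong)
    fix t :: real
    have "(\<integral>\<^sup>+x. G (a \<bullet> x) * k x * ?I (a \<bullet> x + t) \<partial>lborel) =
        (\<integral>\<^sup>+x. G (a \<bullet> (-t *\<^sub>R w + x)) * k (-t *\<^sub>R w + x) * ?I (a \<bullet> (-t *\<^sub>R w + x) + t) \<partial>lborel)"
      by (rule nn_integral_lborel_translate[symmetric]) measurable
    also have "\<dots> = (\<integral>\<^sup>+x. G (a \<bullet> x - t) * k x * ?I (a \<bullet> x) \<partial>lborel)"
      by (intro nn_integral_cong, subst inv) (simp add: inner_add_right inner_diff_right aw)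
    finally show "(\<integral>\<^sup>+x. G (a \<bullet> x) * k x * ?I (a \<bullet> x + t) \<partial>lborel) = \<dots>" .
  qed
  also have "\<dots> = (\<integral>\<^sup>+x. (\<integral>\<^sup>+t. G (a \<bullet> x - t) * k x * ?I (a \<bullet> x) \<partial>lborel) \<partial>lborel)"
    by (rule lborel_pair.Fubini') measurable
  also have "\<dots> = (\<integral>\<^sup>+x. (\<integral>\<^sup>+y. G y \<partial>lborel) * (?I (a \<bullet> x) * k x) \<partial>lborel)"
  proof (rule nn_integral_cong)
    fix x
    have "(\<integral>\<^sup>+t. G (a \<bullet> x - t) * k x * ?I (a \<bullet> x) \<partial>lborel) =
        (\<integral>\<^sup>+t. G (a \<bullet> x - t) * (?I (a \<bullet> x) * k x) \<partial>lborel)"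
      by (simp add: mult_ac)
    also have "\<dots> = (\<integral>\<^sup>+t. G (a \<bullet> x - t) \<partial>lborel) * (?I (a \<bullet> x) * k x)"
      by (rule nn_integral_multc) measurable
    also have "(\<integral>\<^sup>+t. G (a \<bullet> x - t) \<partial>lborel) = (\<integral>\<^sup>+y. G y \<partial>lborel)"
      by (rule nn_integral_real_reflect) measurable
    finally show "(\<integral>\<^sup>+t. G (a \<bullet> x - t) * k x * ?I (a \<bullet> x) \<partial>lborel) =
        (\<integral>\<^sup>+y. G y \<partial>lborel) * (?I (a \<bullet> x) * k x)" .
  qed
  also have "\<dots> = (\<integral>\<^sup>+y. G y \<partial>lborel) * (\<integral>\<^sup>+x. ?I (a \<bullet> x) * k x \<partial>lborel)"
    by (rule nn_integral_cmult) measurable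
  finally show ?thesis .
qed

section \<open>The quadratic form of the inverse matrix and its ellipsoids\<close>

lemma pos_definite_invertible:
  fixes V :: "real ^ 'n ^ 'n"
  assumes "pos_definite V"
  shows "invertible V"
proof -
  have "x = 0" if "V *v x = 0" for x
    using assms that unfolding pos_definite_def by (metis inner_zero_right less_irrefl)
  then show ?thesis
    by (simp add: invertible_left_inverse matrix_left_invertible_ker)
qed

lemma matrix_inv_mul_vec:
  fixes V :: "real ^ 'n ^ 'n"
  assumes "pos_definite V"
  shows "matrix_inv V *v (V *v x) = x" and "V *v (matrix_inv V *v x) = x"
proof -
  have "V ** matrix_inv V = mat 1 \<and> matrix_inv V ** V = mat 1"
    using pos_definite_invertible[OF assms] unfolding invertible_def matrix_inv_def
    by (rule someI_ex)
  then show "matrix_inv V *v (V *v x) = x" "V *v (matrix_inv V *v x) = x"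
    by (simp_all add: matrix_vector_mul_assoc)
qed

lemma symmetric_matrix_inner:
  fixes V :: "real ^ 'n ^ 'n"
  assumes "transpose V = V"
  shows "x \<bullet> (V *v y) = (V *v x) \<bullet> y"
  by (metis assms dot_lmul_matrix transpose_matrix_vector)

text \<open>Along the direction \<open>V *v a\<close> the inverse cancels \<open>V\<close>, so the
  cross term depends on \<open>x\<close> only through \<open>a \<bullet> x\<close>. This one
  expansion yields the Cauchy-Schwarz bound, its equality case, and the translation invariance of
  the tilted normal density.\<close>

lemma matrix_inv_quadratic_add:
  fixes V :: "real ^ 'n ^ 'n"
  assumes "transpose V = V" and "pos_definite V"
  shows "(t *\<^sub>R (V *v a) + x) \<bullet> (matrix_inv V *v (t *\<^sub>R (V *v a) + x)) =
    x \<bullet> (matrix_inv V *v x) + 2 * t * (a \<bullet> x) + t\<^sup>2 * (a \<bullet> (V *v a))"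
proof -
  have 1: "(V *v a) \<bullet> (matrix_inv V *v x) = a \<bullet> x"
    using symmetric_matrix_inner[OF assms(1), of a "matrix_inv V *v x"]
    by (simp add: matrix_inv_mul_vec[OF assms(2)])
  show ?thesis
    by (simp add: matrix_vector_right_distrib matrix_vector_mult_scaleR inner_add_left
        inner_add_right matrix_inv_mul_vec[OF assms(2)] 1 power2_eq_square algebra_simps
        inner_commute)
qed

text \<open>With \<open>y = matrix_inv V *v x\<close> the form becomes
  \<open>y \<bullet> (V *v y)\<close>.\<close>

lemma pos_definite_matrix_inv_nonneg:
  fixes V :: "real ^ 'n ^ 'n"
  assumes "pos_definite V"
  shows "0 \<le> x \<bullet> (matrix_inv V *v x)"
  using assms matrix_inv_mul_vec(2)[OF assms, of x] unfolding pos_definite_def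
  by (metis inner_commute inner_zero_right less_imp_le order_refl)

text \<open>The form at \<open>t *\<^sub>R (V *v a) + x\<close> is a nonnegative quadratic
  polynomial in \<open>t\<close>; its minimum value gives the bound.\<close>

lemma matrix_inv_Cauchy_Schwarz:
  fixes V :: "real ^ 'n ^ 'n"
  assumes "transpose V = V" and "pos_definite V" and "a \<noteq> 0"
  shows "(a \<bullet> x)\<^sup>2 \<le> (a \<bullet> (V *v a)) * (x \<bullet> (matrix_inv V *v x))"
proof -
  define v where "v = a \<bullet> (V *v a)"
  have v: "0 < v" using assms unfolding v_def pos_definite_def by auto
  \<comment> \<open>The minimiser of the quadratic in \<open>t\<close>.\<close>
  define t where "t = - (a \<bullet> x) / v"
  have "0 \<le> x \<bullet> (matrix_inv V *v x) + 2 * t * (a \<bullet> x) + t\<^sup>2 * v"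
    using pos_definite_matrix_inv_nonneg[OF assms(2), of "t *\<^sub>R (V *v a) + x"]
    unfolding matrix_inv_quadratic_add[OF assms(1,2)] v_def .
  also have "\<dots> = x \<bullet> (matrix_inv V *v x) - (a \<bullet> x)\<^sup>2 / v"
    using v by (simp add: t_def power2_eq_square field_simps)
  finally show ?thesis using v unfolding v_def[symmetric] by (simp add: field_simps)
qed

text \<open>Cauchy-Schwarz bounds the deviation of \<open>a \<bullet> x\<close> from
  \<open>a \<bullet> b\<close> by \<open>r\<close>. Equality holds on the line through
  \<open>b\<close> in direction \<open>V *v a\<close>, which meets the ellipsoid at
  \<open>t = sqrt (\<kappa> / v)\<close> and at its negative, so both extrema are attained.\<close>

lemma ellipsoid_linear_extremum:
  fixes V :: "real ^ 'n ^ 'n" and b :: "real ^ 'n"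
  assumes "transpose V = V" and "pos_definite V" and "a \<noteq> 0" and "0 \<le> \<kappa>"
  defines "E \<equiv> {x. (x - b) \<bullet> (matrix_inv V *v (x - b)) = \<kappa>}"
    and "r \<equiv> sqrt (\<kappa> * (a \<bullet> (V *v a)))"
  shows "(GREATEST s. s \<in> (\<lambda>x. a \<bullet> x) ` E) = a \<bullet> b + r"
    and "(LEAST s. s \<in> (\<lambda>x. a \<bullet> x) ` E) = a \<bullet> b - r"
proof -
  define v where "v = a \<bullet> (V *v a)"
  have v: "0 < v" using assms(2,3) unfolding v_def pos_definite_def by auto
  have bound: "\<bar>a \<bullet> x - a \<bullet> b\<bar> \<le> r" if "x \<in> E" for x
  proof -
    have "(a \<bullet> (x - b))\<^sup>2 \<le> v * \<kappa>"
      using matrix_inv_Cauchy_Schwarz[OF assms(1-3), of "x - b"] that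
      by (simp add: E_def v_def)
    then show ?thesis
      unfolding r_def v_def[symmetric] inner_diff_right[symmetric]
      by (intro real_le_rsqrt) (simp add: mult.commute)
  qed
  have "b + t *\<^sub>R (V *v a) \<in> E" if "t\<^sup>2 * v = \<kappa>" for t
    using that matrix_inv_quadratic_add[OF assms(1,2), of t a 0] by (simp add: E_def v_def)
  then have attained: "a \<bullet> b + t * v \<in> (\<lambda>x. a \<bullet> x) ` E" if "t\<^sup>2 * v = \<kappa>" for t
    using that by (intro image_eqI[of _ _ "b + t *\<^sub>R (V *v a)"]) (auto simp: inner_add_right v_def)
  have rv: "sqrt (\<kappa> / v) * v = r"
    using v \<open>0 \<le> \<kappa>\<close> by (simp add: r_def v_def[symmetric] real_sqrt_divide real_sqrt_mult
      real_div_sqrt field_simps)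
  have "a \<bullet> b + r \<in> (\<lambda>x. a \<bullet> x) ` E"
    using attained[of "sqrt (\<kappa> / v)"] rv v \<open>0 \<le> \<kappa>\<close> by simp
  then show "(GREATEST s. s \<in> (\<lambda>x. a \<bullet> x) ` E) = a \<bullet> b + r"
    by (rule Greatest_equality) (auto dest: bound)
  have "a \<bullet> b - r \<in> (\<lambda>x. a \<bullet> x) ` E"
    using attained[of "- sqrt (\<kappa> / v)"] rv v \<open>0 \<le> \<kappa>\<close> by simp
  then show "(LEAST s. s \<in> (\<lambda>x. a \<bullet> x) ` E) = a \<bullet> b - r"
    by (rule Least_equality) (auto dest: bound)
qed

section \<open>The law of a linear functional of a normal vector\<close>

lemma distributed_mv_normal_inner:
  fixes V :: "real ^ 'n ^ 'n" and X :: "'a \<Rightarrow> real ^ 'n"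
  assumes "prob_space M" and sym: "transpose V = V" and pos: "pos_definite V"
    and X: "distributed M lborel X (\<lambda>x. ennreal (mv_normal_density \<mu> V x))"
    and "a \<noteq> 0"
  shows "distributed M lborel (\<lambda>\<omega>. a \<bullet> (X \<omega> - \<mu>)) (normal_density 0 (sqrt (a \<bullet> (V *v a))))"
proof -
  interpret prob_space M by fact
  define v where "v = a \<bullet> (V *v a)"
  have v: "0 < v" using pos \<open>a \<noteq> 0\<close> unfolding v_def pos_definite_def by auto
  define Q where "Q x = x \<bullet> (matrix_inv V *v x)" for x
  define K where "K = 1 / sqrt ((2 * pi) ^ CARD('n) * det V)"
  \<comment> \<open>The centred density tilted by
    \<open>exp ((a \<bullet> x)\<^sup>2 / (2 * v))\<close>: the factor cancels the change of
    \<open>Q\<close> along \<open>V *v a\<close>.\<close>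
  define k where "k x = ennreal (exp ((a \<bullet> x)\<^sup>2 / (2 * v) - Q x / 2)) * ennreal K" for x
  define C where "C = (\<integral>\<^sup>+x. indicator {0..1::real} (a \<bullet> x) * k x \<partial>lborel)"
  have Xm[measurable]: "X \<in> borel_measurable M"
    using distributed_measurable[OF X] by simp
  have [measurable]: "Q \<in> borel_measurable borel"
    unfolding Q_def
    by (intro borel_measurable_continuous_onI continuous_intros
        linear_continuous_on matrix_vector_mul_bounded_linear)
  have "mv_normal_density \<mu> V = (\<lambda>x. exp (- Q (x - \<mu>) / 2) * K)"
    by (simp add: fun_eq_iff mv_normal_density_def Q_def K_def)
  then have [measurable]: "mv_normal_density \<mu> V \<in> borel_measurable borel"
    by simp
  have [measurable]: "k \<in> borel_measurable borel" unfolding k_def by measurable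
  \<comment> \<open>Dividing by \<open>v\<close> normalises the direction, so that a shift by
    \<open>t\<close> times this vector raises \<open>a \<bullet> x\<close> by exactly
    \<open>t\<close>.\<close>
  have aw: "a \<bullet> ((1 / v) *\<^sub>R (V *v a)) = 1"
    using v by (simp add: v_def)
  have k_inv: "k (t *\<^sub>R ((1 / v) *\<^sub>R (V *v a)) + x) = k x" for t x
  proof -
    have "Q (t *\<^sub>R ((1 / v) *\<^sub>R (V *v a)) + x) = Q x + 2 * (t / v) * (a \<bullet> x) + (t / v)\<^sup>2 * v"
      using matrix_inv_quadratic_add[OF sym pos, of "t / v" a x] by (simp add: Q_def v_def)
    moreover have "a \<bullet> (t *\<^sub>R ((1 / v) *\<^sub>R (V *v a)) + x) = t + a \<bullet> x"
      using v by (simp add: inner_add_right v_def)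
    moreover have "(t + a \<bullet> x)\<^sup>2 / (2 * v) - (Q x + 2 * (t / v) * (a \<bullet> x) + (t / v)\<^sup>2 * v) / 2 =
        (a \<bullet> x)\<^sup>2 / (2 * v) - Q x / 2"
      using v by (simp add: power2_eq_square field_simps)
    ultimately show ?thesis
      unfolding k_def by metis
  qed
  have density_k: "ennreal (mv_normal_density \<mu> V (\<mu> + x)) =
      ennreal (exp (- (a \<bullet> x)\<^sup>2 / (2 * v))) * k x" for x
  proof -
    have "mv_normal_density \<mu> V (\<mu> + x) =
        exp (- (a \<bullet> x)\<^sup>2 / (2 * v)) * (exp ((a \<bullet> x)\<^sup>2 / (2 * v) - Q x / 2) * K)"
      by (simp add: mv_normal_density_def K_def Q_def mult.assoc[symmetric] exp_add[symmetric])
    then show ?thesis by (simp add: k_def ennreal_mult')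
  qed
  let ?n = "normal_density 0 (sqrt v)"
  \<comment> \<open>The factor \<open>sqrt (2 * pi * v)\<close> turns
    \<open>exp (- y\<^sup>2 / (2 * v))\<close> into the normal density; \<open>D\<close> collects
    all constants independent of the set \<open>A\<close>.\<close>
  define D where "D = ennreal (sqrt (2 * pi * v)) * C"
  have emeasure_inner: "emeasure M ((\<lambda>\<omega>. a \<bullet> (X \<omega> - \<mu>)) -` A \<inter> space M) =
      D * emeasure (density lborel ?n) A" if [measurable]: "A \<in> sets borel" for A
  proof -
    let ?G = "\<lambda>y. indicator A y * ennreal (exp (- y\<^sup>2 / (2 * v)))"
    have "(\<lambda>\<omega>. a \<bullet> (X \<omega> - \<mu>)) -` A \<inter> space M = X -` ((\<lambda>x. a \<bullet> (x - \<mu>)) -` A) \<inter> space M"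
      by auto
    moreover have "(\<lambda>x. a \<bullet> (x - \<mu>)) -` A \<in> sets borel"
      by (rule measurable_sets_borel[OF _ that]) measurable
    ultimately have "emeasure M ((\<lambda>\<omega>. a \<bullet> (X \<omega> - \<mu>)) -` A \<inter> space M) =
        (\<integral>\<^sup>+x. ennreal (mv_normal_density \<mu> V x) * indicator ((\<lambda>x. a \<bullet> (x - \<mu>)) -` A) x \<partial>lborel)"
      by (simp add: distributed_emeasure[OF X])
    also have "\<dots> = (\<integral>\<^sup>+x. ennreal (mv_normal_density \<mu> V x) * indicator A (a \<bullet> (x - \<mu>)) \<partial>lborel)"
      by (intro nn_integral_cong) (simp split: split_indicator)
    also have "\<dots> = (\<integral>\<^sup>+x. ennreal (mv_normal_density \<mu> V (\<mu> + x)) * indicator A (a \<bullet> (\<mu> + x - \<mu>)) \<partial>lborel)"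
      by (rule nn_integral_lborel_translate[symmetric]) measurable
    also have "\<dots> = (\<integral>\<^sup>+x. ?G (a \<bullet> x) * k x \<partial>lborel)"
      unfolding density_k by (intro nn_integral_cong) (simp add: mult_ac)
    also have "\<dots> = (\<integral>\<^sup>+y. ?G y \<partial>lborel) * C"
      unfolding C_def
      by (rule nn_integral_inner_invariant_kernel[OF _ _ k_inv aw]) measurable
    also have "(\<integral>\<^sup>+y. ?G y \<partial>lborel) =
        (\<integral>\<^sup>+y. ennreal (sqrt (2 * pi * v)) * (ennreal (?n y) * indicator A y) \<partial>lborel)"
      using v
      by (intro nn_integral_cong)
         (auto simp: normal_density_def ennreal_mult'[symmetric] split: split_indicator)
    also have "\<dots> = ennreal (sqrt (2 * pi * v)) * emeasure (density lborel ?n) A"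
      by (subst nn_integral_cmult) (auto simp: emeasure_density)
    finally show ?thesis by (simp add: D_def mult_ac)
  qed
  interpret N: prob_space "density lborel ?n"
    using v by (intro prob_space_normal_density) simp
  \<comment> \<open>Both laws have total mass 1, so taking \<open>A = UNIV\<close> determines
    \<open>D\<close>.\<close>
  have "emeasure M (space M) = D * emeasure (density lborel ?n) UNIV"
    using emeasure_inner[of UNIV] by simp
  then have "D = 1"
    using emeasure_space_1 N.emeasure_space_1 by simp
  then have "distr M lborel (\<lambda>\<omega>. a \<bullet> (X \<omega> - \<mu>)) = density lborel ?n"
    by (intro measure_eqI) (auto simp: emeasure_distr emeasure_inner)
  then show ?thesis
    unfolding distributed_def v_def[symmetric] by auto
qed

section \<open>The chi-square distribution with one degree of freedom as the law of a squared
  standard normal\<close>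

lemma chi_square_density_measurable [measurable]: "chi_square_density k \<in> borel_measurable borel"
  unfolding chi_square_density_def[abs_def] by measurable

text \<open>The Jacobian \<open>2 * z\<close> of \<open>x = z\<^sup>2\<close> cancels the singular
  factor \<open>x powr (-1/2)\<close>, and \<open>Gamma (1/2) = sqrt pi\<close> supplies the normal
  constant. The factor 2 on the right stands for the two roots \<open>z\<close> and
  \<open>-z\<close>.\<close>

lemma chi_square_density_1_square:
  assumes "0 < z"
  shows "chi_square_density 1 (z\<^sup>2) * (2 * z) = 2 * std_normal_density z"
proof -
  have "(z\<^sup>2) powr (- (1 / 2)) = 1 / z"
    using assms by (simp add: powr_minus powr_half_sqrt divide_simps)
  then show ?thesis
    using assms by (simp add: chi_square_density_def std_normal_density_def Gamma_one_half_real
        powr_half_sqrt real_sqrt_mult field_simps)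
qed

text \<open>The density is even, so reflection carries the left half of the interval to the right
  half.\<close>

lemma emeasure_std_normal_symmetric:
  assumes "0 \<le> r"
  shows "emeasure std_normal_distribution {-r..r} =
    (\<integral>\<^sup>+z. ennreal (2 * std_normal_density z) * indicator {0..r} z \<partial>lborel)"
proof -
  let ?\<phi> = "\<lambda>z. ennreal (std_normal_density z)"
  \<comment> \<open>The two halves overlap at 0, so splitting the integrand is valid only almost
    everywhere.\<close>
  have AE0: "AE z in lborel. z \<noteq> (0::real)" by (rule AE_lborel_singleton)
  have "emeasure std_normal_distribution {-r..r} =
      (\<integral>\<^sup>+z. ?\<phi> z * indicator {-r..r} z \<partial>lborel)"
    by (simp add: emeasure_density)
  also have "\<dots> = (\<integral>\<^sup>+z. ?\<phi> z * indicator {-r..0} z + ?\<phi> z * indicator {0..r} z \<partial>lborel)"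
    by (intro nn_integral_cong_AE, use AE0 in eventually_elim)
       (use assms in \<open>auto split: split_indicator\<close>)
  also have "\<dots> = (\<integral>\<^sup>+z. ?\<phi> z * indicator {-r..0} z \<partial>lborel) +
      (\<integral>\<^sup>+z. ?\<phi> z * indicator {0..r} z \<partial>lborel)"
    by (rule nn_integral_add) auto
  also have "(\<integral>\<^sup>+z. ?\<phi> z * indicator {-r..0} z \<partial>lborel) =
      (\<integral>\<^sup>+z. ?\<phi> (0 - z) * indicator {-r..0} (0 - z) \<partial>lborel)"
    by (rule nn_integral_real_reflect[symmetric]) measurable
  also have "\<dots> = (\<integral>\<^sup>+z. ?\<phi> z * indicator {0..r} z \<partial>lborel)"
    by (intro nn_integral_cong) (auto simp: normal_density_def split: split_indicator)
  also have "(\<integral>\<^sup>+z. ?\<phi> z * indicator {0..r} z \<partial>lborel) + (\<integral>\<^sup>+z. ?\<phi> z * indicator {0..r} z \<partial>lborel) =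
      (\<integral>\<^sup>+z. 2 * (?\<phi> z * indicator {0..r} z) \<partial>lborel)"
    by (subst nn_integral_cmult) (auto simp: mult_2)
  also have "\<dots> = (\<integral>\<^sup>+z. ennreal (2 * std_normal_density z) * indicator {0..r} z \<partial>lborel)"
    by (simp add: ennreal_mult' mult.assoc)
  finally show ?thesis .
qed

lemma chi_square_cdf_1_square:
  assumes "0 \<le> r"
  shows "chi_square_cdf 1 (r\<^sup>2) = measure std_normal_distribution {-r..r}"
proof -
  have "emeasure (density lborel (\<lambda>x. ennreal (chi_square_density 1 x))) {..r\<^sup>2} =
      (\<integral>\<^sup>+x. ennreal (chi_square_density 1 x) * indicator {..r\<^sup>2} x \<partial>lborel)"
    by (simp add: emeasure_density)
  \<comment> \<open>The density vanishes for nonpositive arguments. The lower end is written as a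
    square to match the substitution rule for \<open>z \<mapsto> z\<^sup>2\<close>.\<close>
  also have "\<dots> = (\<integral>\<^sup>+x. ennreal (chi_square_density 1 x) * indicator {0\<^sup>2..r\<^sup>2} x \<partial>lborel)"
    by (intro nn_integral_cong) (auto simp: chi_square_density_def split: split_indicator)
  also have "\<dots> = (\<integral>\<^sup>+z. ennreal (chi_square_density 1 (z\<^sup>2) * (2 * z) * indicator {0..r} z) \<partial>lborel)"
    unfolding nn_integral_set_ennreal
    by (rule nn_integral_substitution[where f = "chi_square_density 1" and g = "\<lambda>z. z\<^sup>2"
          and g' = "\<lambda>z. 2 * z" and a = 0 and b = r, unfolded nn_integral_set_ennreal])
       (use assms in \<open>auto simp: set_borel_measurable_def
          intro!: derivative_eq_intros continuous_intros\<close>)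
  also have "\<dots> = (\<integral>\<^sup>+z. ennreal (2 * std_normal_density z) * indicator {0..r} z \<partial>lborel)"
  \<comment> \<open>At \<open>z = 0\<close> the integrands differ: the left one is 0 and the right
    one is positive.\<close>
  proof (intro nn_integral_cong_AE, use AE_lborel_singleton[of "0::real"] in eventually_elim)
    fix z :: real assume "z \<noteq> 0"
    show "ennreal (chi_square_density 1 (z\<^sup>2) * (2 * z) * indicator {0..r} z) =
        ennreal (2 * std_normal_density z) * indicator {0..r} z"
    proof (cases "z \<in> {0..r}")
      case True
      with \<open>z \<noteq> 0\<close> have "0 < z" by simp
      then show ?thesis unfolding chi_square_density_1_square[OF \<open>0 < z\<close>] using True by simp
    qed simp
  qed
  also have "\<dots> = emeasure std_normal_distribution {-r..r}"
    by (rule emeasure_std_normal_symmetric[OF assms, symmetric])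
  finally show ?thesis
    by (simp add: chi_square_cdf_def cdf_def measure_def)
qed

section \<open>The standard normal distribution function and the chi-square quantile\<close>

lemma real_distribution_std_normal: "real_distribution std_normal_distribution"
  by (simp add: real_distribution_def real_distribution_axioms_def prob_space_normal_density)

lemma measure_std_normal_singleton: "measure std_normal_distribution {x} = 0"
proof -
  have "emeasure std_normal_distribution {x} =
      (\<integral>\<^sup>+z. ennreal (std_normal_density z) * indicator {x} z \<partial>lborel)"
    by (simp add: emeasure_density)
  also have "\<dots> = 0"
    by simp
  finally show ?thesis by (simp add: measure_def)
qed

text \<open>The density is positive everywhere, so an interval of mass zero would be a Lebesgue null
  set.\<close>

lemma cdf_std_normal_strict_mono:
  assumes "x < y"
  shows "cdf std_normal_distribution x < cdf std_normal_distribution y"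
proof -
  interpret real_distribution std_normal_distribution by (rule real_distribution_std_normal)
  have "emeasure std_normal_distribution {x<..y} \<noteq> 0"
  proof
    assume "emeasure std_normal_distribution {x<..y} = 0"
    then have "AE z in lborel. z \<notin> {x<..y}"
      by (subst (asm) emeasure_density, simp_all, subst (asm) nn_integral_0_iff_AE)
         (auto elim!: eventually_mono simp: normal_density_pos[THEN less_imp_neq, THEN not_sym]
           split: split_indicator_asm)
    then have "{x<..y} \<in> null_sets lborel"
      by (subst AE_iff_null_sets) auto
    then show False using assms by (simp add: null_sets_def)
  qed
  then have "measure std_normal_distribution {x<..y} > 0"
    by (simp add: emeasure_eq_measure zero_less_measure_iff)
  then show ?thesis using cdf_diff_eq[OF assms] by simp
qed

text \<open>Without atoms, endpoints carry no mass. This links the half-open intervals of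
  \<open>cdf\<close>, the closed ones of the chi-square identity and the open ones of the coverage
  event.\<close>

lemma measure_std_normal_symmetric:
  assumes "0 \<le> r"
  shows "measure std_normal_distribution {-r..r} =
      cdf std_normal_distribution r - cdf std_normal_distribution (-r)"
    and "measure std_normal_distribution {-r<..<r} = measure std_normal_distribution {-r..r}"
proof -
  interpret real_distribution std_normal_distribution by (rule real_distribution_std_normal)
  have null: "{x} \<in> null_sets std_normal_distribution" for x
    using measure_std_normal_singleton[of x] by (auto simp: null_sets_def emeasure_eq_measure)
  have Un: "measure std_normal_distribution (A \<union> {x}) = measure std_normal_distribution A"
    if "A \<in> sets borel" for A x
    using that by (intro measure_Un_null_set null) simp
  show "measure std_normal_distribution {-r..r} =
      cdf std_normal_distribution r - cdf std_normal_distribution (-r)"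
  proof (cases "r = 0")
    case False
    then have "{-r..r} = {-r<..r} \<union> {-r}" using assms by auto
    then show ?thesis using Un[of "{-r<..r}" "-r"] cdf_diff_eq[of "-r" r] False assms by simp
  qed (simp add: measure_std_normal_singleton)
  show "measure std_normal_distribution {-r<..<r} = measure std_normal_distribution {-r..r}"
  proof (cases "r = 0")
    case False
    then have "{-r..r} = ({-r<..<r} \<union> {-r}) \<union> {r}" using assms by auto
    then show ?thesis using Un[of "{-r<..<r}" "-r"] Un[of "{-r<..<r} \<union> {-r}" r] by simp
  qed (simp add: measure_std_normal_singleton)
qed

lemma chi_square_cdf_1_sqrt:
  assumes "0 \<le> x"
  shows "chi_square_cdf 1 x =
    cdf std_normal_distribution (sqrt x) - cdf std_normal_distribution (- sqrt x)"
  using chi_square_cdf_1_square[of "sqrt x"] measure_std_normal_symmetric(1)[of "sqrt x"] assms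
  by simp

text \<open>An inverse taken by \<open>the_inv_into\<close> has meaning only where the map is
  injective and the value is attained; both facts are reduced to the standard normal distribution
  function.\<close>

lemma chi_square_quantile_1:
  assumes "0 < c" and "c < 1"
  shows "0 < chi_square_quantile 1 c" and "chi_square_cdf 1 (chi_square_quantile 1 c) = c"
proof -
  interpret real_distribution std_normal_distribution by (rule real_distribution_std_normal)
  let ?\<Phi> = "cdf std_normal_distribution"
  let ?m = "\<lambda>r. ?\<Phi> r - ?\<Phi> (-r)"
  have "isCont ?\<Phi> x" for x
    using isCont_cdf measure_std_normal_singleton by blast
  then have cont: "isCont ?m x" for x
    by (intro continuous_intros isCont_o2[where g = ?\<Phi> and f = uminus]) auto
  have "((\<lambda>r. ?\<Phi> (- r)) \<longlongrightarrow> 0) at_top"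
    using filterlim_compose[OF cdf_lim_at_bot filterlim_uminus_at_bot_at_top] .
  then have "(?m \<longlongrightarrow> 1 - 0) at_top"
    by (intro tendsto_diff cdf_lim_at_top_prob)
  then have "eventually (\<lambda>r. c < ?m r) at_top"
    using order_tendstoD(1)[of ?m 1 at_top c] assms(2) by simp
  then obtain R where R: "0 \<le> R" "c < ?m R"
    using eventually_happens[OF eventually_conj[OF eventually_ge_at_top[of 0]]] by auto
  \<comment> \<open>\<open>?m\<close> is 0 at 0 and exceeds \<open>c\<close> at \<open>R\<close>;
    the root \<open>r\<close> is the square root of the quantile.\<close>
  have "\<exists>r\<ge>0. r \<le> R \<and> ?m r = c"
    by (rule IVT) (use R cont assms(1) in simp_all)
  then obtain r where r: "0 \<le> r" "?m r = c" by blast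
  \<comment> \<open>Increasing \<open>x\<close> raises the upper normal tail point
    \<open>sqrt x\<close> and lowers \<open>- sqrt x\<close>, so their difference in
    \<open>cdf\<close> strictly grows.\<close>
  have "inj_on (chi_square_cdf 1) {0..}"
  proof (rule strict_mono_on_imp_inj_on, rule strict_mono_onI)
    fix x y :: real assume "x \<in> {0..}" "y \<in> {0..}" "x < y"
    then show "chi_square_cdf 1 x < chi_square_cdf 1 y"
      using cdf_std_normal_strict_mono[of "sqrt x" "sqrt y"]
        cdf_std_normal_strict_mono[of "- sqrt y" "- sqrt x"]
      by (simp add: chi_square_cdf_1_sqrt del: One_nat_def)
  qed
  moreover have "chi_square_cdf 1 (r\<^sup>2) = c"
    using r by (simp add: chi_square_cdf_1_sqrt del: One_nat_def)
  ultimately have "chi_square_quantile 1 c = r\<^sup>2"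
    unfolding chi_square_quantile_def by (intro the_inv_into_f_eq) auto
  moreover have "r \<noteq> 0"
    using r assms(1) by auto
  ultimately show "0 < chi_square_quantile 1 c" "chi_square_cdf 1 (chi_square_quantile 1 c) = c"
    using \<open>chi_square_cdf 1 (r\<^sup>2) = c\<close> by simp_all
qed

theorem proposition1:
  fixes M :: "'a measure"
    and \<beta> :: "real ^ 'n"
    and V :: "real ^ 'n ^ 'n"
    and \<beta>hat :: "'a \<Rightarrow> real ^ 'n"
    and \<alpha> :: real
  assumes "prob_space M"
    and "transpose V = V"
    and "pos_definite V"
    and "distributed M lborel \<beta>hat (\<lambda>x. ennreal (mv_normal_density \<beta> V x))"
    and "0 < \<alpha>" and "\<alpha> < 1"
  shows "measure M {\<omega> \<in> space M.
           (\<Sum>h\<in>UNIV. lower_bound \<alpha> V (\<beta>hat \<omega>) $ h) / real CARD('n)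
             < (\<Sum>h\<in>UNIV. \<beta> $ h) / real CARD('n) \<and>
           (\<Sum>h\<in>UNIV. \<beta> $ h) / real CARD('n)
             < (\<Sum>h\<in>UNIV. upper_bound \<alpha> V (\<beta>hat \<omega>) $ h) / real CARD('n)}
         = 1 - \<alpha>"
proof -
  interpret prob_space M by fact
  \<comment> \<open>The vector whose entries are all 1, so that \<open>a \<bullet> x\<close> is the
    cumulative effect.\<close>
  define a :: "real ^ 'n" where "a = 1"
  have a: "a \<noteq> 0" by (simp add: a_def)
  have sum_a: "(\<Sum>h\<in>UNIV. x $ h) = a \<bullet> x" for x :: "real ^ 'n"
    by (simp add: a_def inner_vec_def)
  define \<kappa> where "\<kappa> = chi_square_quantile 1 (1 - \<alpha>)"
  have \<kappa>: "0 < \<kappa>" "chi_square_cdf 1 \<kappa> = 1 - \<alpha>"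
    using chi_square_quantile_1[of "1 - \<alpha>"] assms(5,6) by (simp_all add: \<kappa>_def)
  define v where "v = a \<bullet> (V *v a)"
  have v: "0 < v" using assms(3) a unfolding v_def pos_definite_def by auto
  note extremum = ellipsoid_linear_extremum[OF assms(2,3) a less_imp_le[OF \<kappa>(1)],
      folded v_def, unfolded \<kappa>_def]
  \<comment> \<open>Summing the constant path over all horizons undoes the division by
    \<open>CARD('n)\<close> and recovers the extremal cumulative effect.\<close>
  have upper: "(\<Sum>h\<in>UNIV. upper_bound \<alpha> V b $ h) = a \<bullet> b + sqrt (\<kappa> * v)" for b
    by (simp add: upper_bound_def max_cumulative_def plausible_paths_def sum_a extremum \<kappa>_def
        del: One_nat_def)
  have lower: "(\<Sum>h\<in>UNIV. lower_bound \<alpha> V b $ h) = a \<bullet> b - sqrt (\<kappa> * v)" for b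
    by (simp add: lower_bound_def min_cumulative_def plausible_paths_def sum_a extremum \<kappa>_def
        del: One_nat_def)
  define Z where "Z \<omega> = a \<bullet> (\<beta>hat \<omega> - \<beta>) / sqrt v" for \<omega>
  have Z: "distributed M lborel Z std_normal_density"
    using normal_standard_normal_convert[of "sqrt v" "\<lambda>\<omega>. a \<bullet> (\<beta>hat \<omega> - \<beta>)" 0]
      distributed_mv_normal_inner[OF assms(1-4) a] v
    by (simp add: v_def[symmetric] Z_def[abs_def])
  \<comment> \<open>After cancelling \<open>CARD('n)\<close>, both inequalities are divided by
    \<open>sqrt v\<close>. Negating the deviation from \<open>b - \<beta>\<close> to
    \<open>\<beta> - b\<close> is harmless because the interval is symmetric.\<close>
  have within: "(a \<bullet> b - sqrt (\<kappa> * v)) / real CARD('n) < (a \<bullet> \<beta>) / real CARD('n) \<and>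
        (a \<bullet> \<beta>) / real CARD('n) < (a \<bullet> b + sqrt (\<kappa> * v)) / real CARD('n) \<longleftrightarrow>
      a \<bullet> (b - \<beta>) / sqrt v \<in> {- sqrt \<kappa><..<sqrt \<kappa>}" (is "?lhs \<longleftrightarrow> ?rhs") for b
  proof -
    have "?lhs \<longleftrightarrow> - (sqrt \<kappa> * sqrt v) < a \<bullet> (b - \<beta>) \<and> a \<bullet> (b - \<beta>) < sqrt \<kappa> * sqrt v"
      by (simp add: divide_less_cancel real_sqrt_mult inner_diff_right) linarith
    also have "\<dots> \<longleftrightarrow> ?rhs"
      using v by (simp add: pos_less_divide_eq pos_divide_less_eq)
    finally show ?thesis .
  qed
  have "{\<omega> \<in> space M.
           (\<Sum>h\<in>UNIV. lower_bound \<alpha> V (\<beta>hat \<omega>) $ h) / real CARD('n)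
             < (\<Sum>h\<in>UNIV. \<beta> $ h) / real CARD('n) \<and>
           (\<Sum>h\<in>UNIV. \<beta> $ h) / real CARD('n)
             < (\<Sum>h\<in>UNIV. upper_bound \<alpha> V (\<beta>hat \<omega>) $ h) / real CARD('n)} =
      Z -` {- sqrt \<kappa><..<sqrt \<kappa>} \<inter> space M"
    unfolding upper lower sum_a[of \<beta>] within Z_def by auto
  moreover have "measure M (Z -` {- sqrt \<kappa><..<sqrt \<kappa>} \<inter> space M) =
      measure std_normal_distribution {- sqrt \<kappa><..<sqrt \<kappa>}"
    unfolding distributed_distr_eq_density[OF Z, symmetric]
    by (rule measure_distr[OF distributed_measurable[OF Z], symmetric]) simp
  moreover have "\<dots> = 1 - \<alpha>"
    using \<kappa> chi_square_cdf_1_square[of "sqrt \<kappa>"] measure_std_normal_symmetric(2)[of "sqrt \<kappa>"]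
    by simp
  ultimately show ?thesis by simp
qed

end
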